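(* Let $g=(g_{ij})$ be a complete Riemannian metric on $\mathbb{R}^2$ with finite total area, and suppose there are constants $C_2\ge C_1>0$ and $r_1>1$ such that $$\frac{C_1}{r^2(\log r)^2}\delta_{ij}\le g_{ij}(x)\le\frac{C_2}{r^2(\log r)^2}\delta_{ij}\quad\text{for all }x\in\mathbb{R}^2\text{ with } r=|x|\ge r_1.$$ Set $\lambda_i(r)=\dfrac{C_i}{r^2(\log r)^2}$ for $i=1,2$. Then there exist constants $c_0>1$, $\delta>0$, $b_1>0$, $b_2>0$ and $r_0\ge r_1$ such that for all $r\ge r_0$: (i) $\int_r^{c_0r}\sqrt{\lambda_1(\rho)}\,d\rho\ge\pi r\sqrt{\lambda_2(r)}$; (ii) $r\sqrt{\lambda_1(c_0r)}\ge b_1\int_r^{\infty}\rho\lambda_2(\rho)\,d\rho$; (iii) $\int_r^{r^2}\sqrt{\lambda_1(\rho)}\,d\rho\ge b_2$; (iv) $\lambda_1(c_0r)\ge\delta\lambda_2(r)$.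
   Context: $|x|$ is the Euclidean norm of $x$; inequalities between $g_{ij}$ and multiples of $\delta_{ij}$ are inequalities of quadratic forms. *)

theory Defs
  imports "HOL-Analysis.Analysis"
begin

fun Ck :: "nat \<Rightarrow> ('a::euclidean_space \<Rightarrow> real) \<Rightarrow> bool" where
  "Ck 0 f \<longleftrightarrow> continuous_on UNIV f"
| "Ck (Suc k) f \<longleftrightarrow>
     f differentiable_on UNIV \<and> (\<forall>b\<in>Basis. Ck k (\<lambda>x. frechet_derivative f (at x) b))"

definition smooth :: "('a::euclidean_space \<Rightarrow> real) \<Rightarrow> bool" where
  "smooth f \<longleftrightarrow> (\<forall>k. Ck k f)"

definition quad_form :: "real^'n^'n \<Rightarrow> real^'n \<Rightarrow> real" where
  "quad_form A v = v \<bullet> (A *v v)"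

definition quad_form_le :: "real^'n^'n \<Rightarrow> real^'n^'n \<Rightarrow> bool" where
  "quad_form_le A B \<longleftrightarrow> (\<forall>v. quad_form A v \<le> quad_form B v)"

definition riemannian_metric :: "(real^'n \<Rightarrow> real^'n^'n) \<Rightarrow> bool" where
  "riemannian_metric g \<longleftrightarrow>
     (\<forall>i j. smooth (\<lambda>x. g x $ i $ j)) \<and>
     (\<forall>x. transpose (g x) = g x) \<and>
     (\<forall>x v. v \<noteq> 0 \<longrightarrow> quad_form (g x) v > 0)"

text \<open>
  Lengths are extended nonnegative reals: \<^const>\<open>valid_path\<close> does not bound the derivative near
  the finitely many exceptional parameters, so a path may have infinite length.
  Where the path is not differentiable the integrand is an irrelevant value on a finite set.
\<close>

definition riem_length :: "(real^'n \<Rightarrow> real^'n^'n) \<Rightarrow> (real \<Rightarrow> real^'n) \<Rightarrow> ennreal" where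
  "riem_length g \<gamma> =
     (\<integral>\<^sup>+ t \<in> {0..1}. ennreal (sqrt (quad_form (g (\<gamma> t)) (vector_derivative \<gamma> (at t)))) \<partial>lborel)"

definition riem_dist :: "(real^'n \<Rightarrow> real^'n^'n) \<Rightarrow> real^'n \<Rightarrow> real^'n \<Rightarrow> real" where
  "riem_dist g x y =
     enn2real (INF \<gamma> \<in> {\<gamma>. valid_path \<gamma> \<and> pathstart \<gamma> = x \<and> pathfinish \<gamma> = y}. riem_length g \<gamma>)"

definition complete_riemannian_metric :: "(real^'n \<Rightarrow> real^'n^'n) \<Rightarrow> bool" where
  "complete_riemannian_metric g \<longleftrightarrow>
     riemannian_metric g \<and> Metric_space.mcomplete UNIV (riem_dist g)"

definition total_area :: "(real^2 \<Rightarrow> real^2^2) \<Rightarrow> ennreal" where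
  "total_area g = (\<integral>\<^sup>+ x. ennreal (sqrt (det (g x))) \<partial>lborel)"

definition lam :: "real \<Rightarrow> real \<Rightarrow> real" where
  "lam C r = C / (r\<^sup>2 * (ln r)\<^sup>2)"

end

theory Submission
  imports Defs
begin

lemma sqrt_lam:
  assumes "1 < x"
  shows "sqrt (lam C x) = sqrt C / (x * ln x)"
  using assms by (simp add: lam_def real_sqrt_divide real_sqrt_mult)

text \<open>For arguments above 1 the integrand is \<open>sqrt C / (x * ln x)\<close>, the
  derivative of \<open>sqrt C * ln (ln x)\<close>.\<close>

lemma integral_sqrt_lam:
  assumes "1 < r" "r \<le> s"
  shows "integral {r..s} (\<lambda>x. sqrt (lam C x)) = sqrt C * ln (ln s / ln r)"
proof -
  have "((\<lambda>x. sqrt C / (x * ln x)) has_integral (sqrt C * ln (ln s) - sqrt C * ln (ln r))) {r..s}"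
    using assms
    by (intro fundamental_theorem_of_calculus)
       (auto intro!: derivative_eq_intros simp: has_real_derivative_iff_has_vector_derivative [symmetric])
  then have "((\<lambda>x. sqrt (lam C x)) has_integral (sqrt C * ln (ln s) - sqrt C * ln (ln r))) {r..s}"
    using assms by (elim has_integral_eq [rotated]) (simp add: sqrt_lam)
  then show ?thesis
    using assms by (simp add: integral_unique ln_div right_diff_distrib)
qed

text \<open>The integrand is \<open>C / (x * (ln x)\<^sup>2)\<close>, with antiderivative
  \<open>- C / ln x\<close>, which vanishes at infinity.\<close>

lemma has_integral_mult_lam:
  assumes "1 < r" "0 \<le> C"
  shows "((\<lambda>x. x * lam C x) has_integral C / ln r) {r..}"
proof -
  let ?f = "\<lambda>x. x * lam C x"
  have meas [measurable]: "?f \<in> borel_measurable borel"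
    unfolding lam_def by measurable
  have deriv: "((\<lambda>x. - C / ln x) has_real_derivative ?f x) (at x)" if "r \<le> x" for x
    using assms that
    by (auto intro!: derivative_eq_intros simp: lam_def power2_eq_square field_simps)
  have lim: "((\<lambda>x. - C / ln x) \<longlongrightarrow> 0) at_top"
    by (intro tendsto_divide_0 [OF tendsto_const] filterlim_at_top_imp_at_infinity ln_at_top)
  \<comment> \<open>Since the integrand is nonnegative, the integral over the unbounded ray is
    computed as a Lebesgue integral, and this value then yields the gauge integral.\<close>
  have "(\<integral>\<^sup>+ x. ennreal (?f x) * indicator {r..} x \<partial>lborel) = ennreal (0 - (- C / ln r))"
    using assms
    by (intro nn_integral_FTC_atLeast [OF meas deriv _ lim]) (auto simp: lam_def)
  then have "(\<integral>\<^sup>+ x. ennreal (?f x * indicator {r..} x) \<partial>lborel) = ennreal (C / ln r)"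
    by (simp add: ennreal_mult'' ennreal_indicator)
  then have "((\<lambda>x. ?f x * indicator {r..} x) has_integral C / ln r) UNIV"
    using assms
    by (intro nn_integral_has_integral) (auto simp: lam_def indicator_def)
  then show ?thesis
    by (subst has_integral_restrict_UNIV [symmetric])
       (simp add: indicator_def of_bool_def if_distrib cong: if_cong)
qed

theorem proposition2:
  fixes g :: "real^2 \<Rightarrow> real^2^2" and C1 C2 r1 :: real
  assumes "complete_riemannian_metric g"
    and "total_area g < \<infinity>"
    and "C1 > 0" and "C2 \<ge> C1" and "r1 > 1"
    and "\<And>x. norm x \<ge> r1 \<Longrightarrow>
           quad_form_le (mat (lam C1 (norm x))) (g x) \<and> quad_form_le (g x) (mat (lam C2 (norm x)))"
  shows "\<exists>c0 \<delta> b1 b2 r0 :: real. c0 > 1 \<and> \<delta> > 0 \<and> b1 > 0 \<and> b2 > 0 \<and> r0 \<ge> r1 \<and>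
    (\<forall>r\<ge>r0.
      integral {r..c0 * r} (\<lambda>\<rho>. sqrt (lam C1 \<rho>)) \<ge> pi * r * sqrt (lam C2 r) \<and>
      ((\<lambda>\<rho>. \<rho> * lam C2 \<rho>) integrable_on {r..} \<and>
       r * sqrt (lam C1 (c0 * r)) \<ge> b1 * integral {r..} (\<lambda>\<rho>. \<rho> * lam C2 \<rho>)) \<and>
      integral {r..r\<^sup>2} (\<lambda>\<rho>. sqrt (lam C1 \<rho>)) \<ge> b2 \<and>
      lam C1 (c0 * r) \<ge> \<delta> * lam C2 r)"
proof -
  \<comment> \<open>\<open>L\<close> is chosen so that (i) becomes \<open>ln (1 + L / x) \<ge> L / (2 * x)\<close> for \<open>x = ln r\<close>, which holds
    once \<open>x \<ge> L\<close>, that is \<open>r \<ge> c0\<close>; then also \<open>ln (c0 * r) = x + L \<le> 2 * x\<close>, which gives (ii) and (iv).\<close>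
  define L where "L = 2 * pi * sqrt C2 / sqrt C1"
  define c0 where "c0 = exp L"
  have C: "C1 > 0" "C2 > 0" using assms by auto
  have L: "L > 0" using C by (simp add: L_def)
  have c0: "c0 > 1" using L by (simp add: c0_def)
  have main: "integral {r..c0 * r} (\<lambda>\<rho>. sqrt (lam C1 \<rho>)) \<ge> pi * r * sqrt (lam C2 r)"
    "(\<lambda>\<rho>. \<rho> * lam C2 \<rho>) integrable_on {r..}"
    "r * sqrt (lam C1 (c0 * r)) \<ge>
       sqrt C1 / (2 * c0 * C2) * integral {r..} (\<lambda>\<rho>. \<rho> * lam C2 \<rho>)"
    "integral {r..r\<^sup>2} (\<lambda>\<rho>. sqrt (lam C1 \<rho>)) \<ge> sqrt C1 * ln 2"
    "lam C1 (c0 * r) \<ge> C1 / (4 * c0\<^sup>2 * C2) * lam C2 r"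
    if r: "r \<ge> max r1 c0" for r
  proof -
    define x where "x = ln r"
    have r1: "r > 1" using r c0 by simp
    have x: "x > 0" using r1 by (simp add: x_def)
    have xL: "x \<ge> L" using r r1 by (simp add: x_def c0_def ln_ge_iff)
    have ln_c0r: "ln (c0 * r) = x + L"
      using r1 by (simp add: x_def c0_def ln_mult)
    have c0r: "c0 * r > 1" "r \<le> c0 * r"
      using c0 r1 less_1_mult by auto
    \<comment> \<open>The left side is \<open>pi * sqrt C2 / x\<close>; the definition of
      \<open>L\<close> turns \<open>pi * sqrt C2\<close> into
      \<open>sqrt C1 * L / 2\<close>.\<close>
    have "pi * r * sqrt (lam C2 r) = sqrt C1 * (L / (2 * x))"
      using r1 C by (simp add: sqrt_lam L_def x_def)
    also have "\<dots> \<le> sqrt C1 * (L / (x + L))"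
      using x L xL C by (intro mult_left_mono divide_left_mono) auto
    also have "L / (x + L) \<le> ln ((x + L) / x)"
    proof -
      \<comment> \<open>Applying \<open>ln y \<le> y - 1\<close> to the reciprocal ratio bounds
        \<open>ln ((x + L) / x)\<close> from below.\<close>
      have "ln (x / (x + L)) \<le> x / (x + L) - 1"
        using x L by (intro ln_le_minus_one) auto
      then show ?thesis
        using x L by (simp add: ln_div field_simps)
    qed
    \<comment> \<open>The chain continues with this inequality, the preceding bound multiplied by
      \<open>sqrt C1\<close>.\<close>
    then have "sqrt C1 * (L / (x + L)) \<le> integral {r..c0 * r} (\<lambda>\<rho>. sqrt (lam C1 \<rho>))"
      unfolding integral_sqrt_lam [OF r1 c0r(2)] ln_c0r x_def [symmetric]
      using C by (intro mult_left_mono) auto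
    finally show "integral {r..c0 * r} (\<lambda>\<rho>. sqrt (lam C1 \<rho>)) \<ge> pi * r * sqrt (lam C2 r)" .
    have int: "((\<lambda>\<rho>. \<rho> * lam C2 \<rho>) has_integral C2 / x) {r..}"
      using has_integral_mult_lam [OF r1] C by (simp add: x_def)
    then show "(\<lambda>\<rho>. \<rho> * lam C2 \<rho>) integrable_on {r..}" by blast
    \<comment> \<open>In \<open>b1\<close>, the factor \<open>C2\<close> cancels that of the
      integral \<open>C2 / x\<close>, \<open>c0\<close> comes from \<open>r / (c0 * r)\<close>, and
      2 pays for \<open>x + L \<le> 2 * x\<close>.\<close>
    have "sqrt C1 / (2 * c0 * C2) * (C2 / x) = sqrt C1 / (c0 * (2 * x))"
      using C by simp
    also have "\<dots> \<le> sqrt C1 / (c0 * (x + L))"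
      using x L xL C c0 by (intro divide_left_mono) auto
    also have "\<dots> = r * sqrt (lam C1 (c0 * r))"
      using r1 c0r(1) by (simp add: sqrt_lam ln_c0r)
    finally show "r * sqrt (lam C1 (c0 * r)) \<ge>
        sqrt C1 / (2 * c0 * C2) * integral {r..} (\<lambda>\<rho>. \<rho> * lam C2 \<rho>)"
      using int by (simp add: integral_unique)
    \<comment> \<open>As \<open>ln (r\<^sup>2) / ln r = 2\<close>, the integral equals
      \<open>sqrt C1 * ln 2\<close> for every such \<open>r\<close>.\<close>
    have "r \<le> r\<^sup>2" using r1 by (simp add: power2_eq_square)
    then show "integral {r..r\<^sup>2} (\<lambda>\<rho>. sqrt (lam C1 \<rho>)) \<ge> sqrt C1 * ln 2"
      using r1 by (simp add: integral_sqrt_lam ln_realpow)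
    \<comment> \<open>Here \<delta> exchanges \<open>C2\<close> for \<open>C1\<close> and rescales
      \<open>r\<close> to \<open>c0 * r\<close>; its 4 is the square of the 2 in
      \<open>x + L \<le> 2 * x\<close>.\<close>
    have "C1 / (4 * c0\<^sup>2 * C2) * lam C2 r = C1 / ((c0 * r)\<^sup>2 * (2 * x)\<^sup>2)"
      using C by (simp add: lam_def x_def power_mult_distrib)
    also have "\<dots> \<le> C1 / ((c0 * r)\<^sup>2 * (x + L)\<^sup>2)"
      using x L xL C c0 r1 by (intro divide_left_mono mult_left_mono power_mono) auto
    finally show "lam C1 (c0 * r) \<ge> C1 / (4 * c0\<^sup>2 * C2) * lam C2 r"
      by (simp add: lam_def ln_c0r)
  qed
  show ?thesis
    by (rule exI [of _ c0], rule exI [of _ "C1 / (4 * c0\<^sup>2 * C2)"],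
        rule exI [of _ "sqrt C1 / (2 * c0 * C2)"], rule exI [of _ "sqrt C1 * ln 2"],
        rule exI [of _ "max r1 c0"])
       (use main C c0 in simp)
qed

end
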